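(* Let $X$ be a compact Hausdorff space, let $A$ be a Banach algebra, and let $\tau : C(X,A)\to C(X,A)$ be a continuous algebra homomorphism. For $x\in X$ let $T_x:C(X,A)\to A$ be $T_x(f)=f(x)$, and let $\tilde{\tau}_x:A\to A$ be the continuous homomorphism $\tilde{\tau}_x(a):=T_x(\tau(1_a))$, where $1_a\in C(X,A)$ is the constant function with value $a$. Suppose that $T_{x_0}\tau=\tilde{\tau}_{x_0}T_{x_0}$ for some $x_0\in X$. If $C(X,A)$ is $\tau$-amenable, then $A$ is $\tilde{\tau}_{x_0}$-amenable.
   Context: $C(X,A)$ denotes the Banach algebra of all continuous functions $X\to A$ with pointwise operations and norm $\|f\|_\infty=\sup_{x\in X}\|f(x)\|$. Let $B$ be a Banach algebra, $\theta:B\to B$ a continuous homomorphism and $E$ a Banach $B$-bimodule. A $\theta$-derivation is a bounded linear map $D:B\to E$ with $D(ab)=D(a)\cdot\theta(b)+\theta(a)\cdot D(b)$ for all $a,b\in B$. It is $\theta$-inner if there is $x\in E$ with $D(a)=\theta(a)\cdot x-x\cdot\theta(a)$ for all $a\in B$. $B$ is $\theta$-amenable if for every Banach $B$-bimodule $E$, every $\theta$-derivation $D:B\to E^*$ is $\theta$-inner, where $E^*$ carries the usual dual bimodule structure. *)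

theory Defs
  imports "HOL-Analysis.Analysis"
begin

section \<open>Complex Banach algebras\<close>

text \<open>Banach algebras are complex and need not have a unit. The distribution only has real
  normed algebras, so the complex scalar multiplication is added on top of them.\<close>

class complex_banach_algebra = real_normed_algebra + banach +
  fixes scaleC :: "complex \<Rightarrow> 'a \<Rightarrow> 'a"  (infixr \<open>*\<^sub>C\<close> 75)
  assumes scaleC_add_right: "c *\<^sub>C (x + y) = c *\<^sub>C x + c *\<^sub>C y"
    and scaleC_add_left: "(c + d) *\<^sub>C x = c *\<^sub>C x + d *\<^sub>C x"
    and scaleC_scaleC: "c *\<^sub>C (d *\<^sub>C x) = (c * d) *\<^sub>C x"
    and scaleC_of_real: "complex_of_real r *\<^sub>C x = r *\<^sub>R x"
    and norm_scaleC: "norm (c *\<^sub>C x) = cmod c * norm x"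
    and mult_scaleC_left: "(c *\<^sub>C x) * y = c *\<^sub>C (x * y)"
    and mult_scaleC_right: "x * (c *\<^sub>C y) = c *\<^sub>C (x * y)"

definition continuous_algebra_hom ::
    "('a::complex_banach_algebra \<Rightarrow> 'b::complex_banach_algebra) \<Rightarrow> bool" where
  "continuous_algebra_hom \<theta> \<longleftrightarrow>
     (\<forall>a b. \<theta> (a + b) = \<theta> a + \<theta> b) \<and>
     (\<forall>c a. \<theta> (c *\<^sub>C a) = c *\<^sub>C \<theta> a) \<and>
     (\<forall>a b. \<theta> (a * b) = \<theta> a * \<theta> b) \<and>
     continuous_on UNIV \<theta>"


section \<open>The Banach algebra $C(X,A)$\<close>

text \<open>For compact \<open>X\<close> every continuous function is bounded, so the library type
  \<open>'x \<Rightarrow>\<^sub>C 'a\<close> of bounded continuous functions with the supremum norm is $C(X,A)$.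
  Below it becomes a complex Banach algebra under the pointwise operations; the library has
  completeness only for metric domains.\<close>

instance bcontfun :: (topological_space, complete_space) complete_space
proof
  fix f :: "nat \<Rightarrow> ('a, 'b) bcontfun"
  assume "Cauchy f"
  then obtain g where "uniform_limit UNIV f g sequentially"
    using uniformly_convergent_eq_cauchy[of "\<lambda>_. True" f]
    unfolding Cauchy_def uniform_limit_sequentially_iff
    by (metis dist_fun_lt_imp_dist_val_lt)
  from uniform_limit_bcontfunE[OF this sequentially_bot]
  obtain l' where "g = apply_bcontfun l'" "(f \<longlonglongrightarrow> l')" by metis
  then show "convergent f"
    by (intro convergentI)
qed

instance bcontfun :: (topological_space, banach) banach ..

setup_lifting type_definition_bcontfun

lemma scaleC_bounded_linear: "bounded_linear (\<lambda>x::'a::complex_banach_algebra. c *\<^sub>C x)"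
proof (rule bounded_linear_intro[where K = "cmod c"])
  fix x y :: 'a and r :: real
  show "c *\<^sub>C (x + y) = c *\<^sub>C x + c *\<^sub>C y" by (rule scaleC_add_right)
  show "c *\<^sub>C (r *\<^sub>R x) = r *\<^sub>R (c *\<^sub>C x)"
    by (simp add: scaleC_of_real[symmetric] scaleC_scaleC mult.commute)
  show "norm (c *\<^sub>C x) \<le> norm x * cmod c" by (simp add: norm_scaleC mult.commute)
qed

instantiation bcontfun :: (topological_space, complex_banach_algebra) complex_banach_algebra
begin

lift_definition times_bcontfun :: "('a \<Rightarrow>\<^sub>C 'b) \<Rightarrow> ('a \<Rightarrow>\<^sub>C 'b) \<Rightarrow> 'a \<Rightarrow>\<^sub>C 'b"
  is "\<lambda>f g x. f x * g x"
proof -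
  fix f g :: "'a \<Rightarrow> 'b"
  assume "f \<in> bcontfun" "g \<in> bcontfun"
  then have cont: "continuous_on UNIV f" "continuous_on UNIV g"
    and bdd: "bounded (range f)" "bounded (range g)"
    by (auto simp: bcontfun_def)
  obtain K L where "\<And>x. norm (f x) \<le> K" "\<And>x. norm (g x) \<le> L"
    using bdd unfolding bounded_iff by auto
  then have "norm (f x * g x) \<le> K * L" for x
    by (meson mult_mono norm_ge_zero norm_mult_ineq order_trans)
  then show "(\<lambda>x. f x * g x) \<in> bcontfun"
    by (intro bcontfun_normI) (auto intro!: continuous_intros cont)
qed

lift_definition scaleC_bcontfun :: "complex \<Rightarrow> ('a \<Rightarrow>\<^sub>C 'b) \<Rightarrow> 'a \<Rightarrow>\<^sub>C 'b"
  is "\<lambda>c f x. c *\<^sub>C f x"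
proof -
  fix c and f :: "'a \<Rightarrow> 'b"
  assume f: "f \<in> bcontfun"
  then have "bounded ((\<lambda>x. c *\<^sub>C x) ` range f)"
    by (intro bounded_linear_image scaleC_bounded_linear) (auto simp: bcontfun_def)
  with f show "(\<lambda>x. c *\<^sub>C f x) \<in> bcontfun"
    by (auto simp: bcontfun_def image_image
        intro!: bounded_linear.continuous_on[OF scaleC_bounded_linear])
qed

lemmas [simp] = times_bcontfun.rep_eq scaleC_bcontfun.rep_eq

instance
proof
  fix f g h :: "'a \<Rightarrow>\<^sub>C 'b" and c d :: complex and r :: real
  show "f * g * h = f * (g * h)" "(f + g) * h = f * h + g * h" "f * (g + h) = f * g + f * h"
    by (auto intro!: bcontfun_eqI simp: algebra_simps)
  show "(r *\<^sub>R f) * g = r *\<^sub>R (f * g)" "f * (r *\<^sub>R g) = r *\<^sub>R (f * g)"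
    by (auto intro!: bcontfun_eqI)
  show "norm (f * g) \<le> norm f * norm g"
  proof (rule norm_bound)
    fix x
    show "norm (apply_bcontfun (f * g) x) \<le> norm f * norm g"
      using norm_mult_ineq[of "f x" "g x"] norm_bounded[of f x] norm_bounded[of g x]
        mult_mono[of "norm (f x)" "norm f" "norm (g x)" "norm g"] by auto
  qed
  show "c *\<^sub>C (f + g) = c *\<^sub>C f + c *\<^sub>C g" "(c + d) *\<^sub>C f = c *\<^sub>C f + d *\<^sub>C f"
    "c *\<^sub>C (d *\<^sub>C f) = (c * d) *\<^sub>C f" "complex_of_real r *\<^sub>C f = r *\<^sub>R f"
    "(c *\<^sub>C f) * g = c *\<^sub>C (f * g)" "f * (c *\<^sub>C g) = c *\<^sub>C (f * g)"
    by (auto intro!: bcontfun_eqI simp: scaleC_add_right scaleC_add_left scaleC_scaleC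
        scaleC_of_real mult_scaleC_left mult_scaleC_right)
  have le: "norm (c *\<^sub>C f) \<le> cmod c * norm f" for c and f :: "'a \<Rightarrow>\<^sub>C 'b"
    by (rule norm_bound) (auto simp: norm_scaleC intro!: mult_left_mono norm_bounded)
  show "norm (c *\<^sub>C f) = cmod c * norm f"
  proof (cases "c = 0")
    case True
    then show ?thesis using le[of 0 f] by simp
  next
    case False
    then have "f = inverse c *\<^sub>C (c *\<^sub>C f)"
      using scaleC_of_real[of 1 "apply_bcontfun f _"]
      by (auto intro!: bcontfun_eqI simp: scaleC_scaleC)
    then have "norm f \<le> cmod (inverse c) * norm (c *\<^sub>C f)"
      using le[of "inverse c" "c *\<^sub>C f"] by simp
    with False have "cmod c * norm f \<le> norm (c *\<^sub>C f)"
      by (simp add: norm_inverse norm_divide field_simps)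
    with le[of c f] show ?thesis by simp
  qed
qed

end

definition eval_at :: "'x \<Rightarrow> ('x::topological_space \<Rightarrow>\<^sub>C 'a::complex_banach_algebra) \<Rightarrow> 'a" where
  "eval_at x f = apply_bcontfun f x"

definition tilde_hom ::
    "(('x::topological_space \<Rightarrow>\<^sub>C 'a::complex_banach_algebra) \<Rightarrow> ('x \<Rightarrow>\<^sub>C 'a)) \<Rightarrow> 'x \<Rightarrow> 'a \<Rightarrow> 'a" where
  "tilde_hom \<tau> x a = eval_at x (\<tau> (const_bcontfun a))"

lemma continuous_algebra_hom_tilde:
  assumes "continuous_algebra_hom \<tau>"
  shows "continuous_algebra_hom (tilde_hom \<tau> x)"
proof -
  have c: "(const_bcontfun (a + b) :: 'a \<Rightarrow>\<^sub>C 'b) = const_bcontfun a + const_bcontfun b"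
    "(const_bcontfun (a * b) :: 'a \<Rightarrow>\<^sub>C 'b) = const_bcontfun a * const_bcontfun b"
    "(const_bcontfun (k *\<^sub>C a) :: 'a \<Rightarrow>\<^sub>C 'b) = k *\<^sub>C const_bcontfun a"
    for a b :: "'b" and k
    by (auto intro!: bcontfun_eqI)
  have "continuous_on UNIV (\<lambda>f :: 'a \<Rightarrow>\<^sub>C 'b. apply_bcontfun f x)"
    unfolding continuous_on_iff by (meson dist_bounded le_less_trans)
  moreover have "continuous_on UNIV (const_bcontfun :: 'b \<Rightarrow> 'a \<Rightarrow>\<^sub>C 'b)"
  proof -
    have "dist (const_bcontfun a :: 'a \<Rightarrow>\<^sub>C 'b) (const_bcontfun b) \<le> dist a b" for a b
      by (rule dist_bound) simp
    then show ?thesis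
      unfolding continuous_on_iff by (meson le_less_trans)
  qed
  moreover have "continuous_on UNIV \<tau>"
    using assms by (simp add: continuous_algebra_hom_def)
  ultimately have "continuous_on UNIV (\<lambda>a. apply_bcontfun (\<tau> (const_bcontfun a)) x)"
    by (intro continuous_on_compose2[of UNIV "\<lambda>f. apply_bcontfun f x" UNIV "\<lambda>a. \<tau> (const_bcontfun a)"]
        continuous_on_compose2[of UNIV \<tau> UNIV const_bcontfun]) auto
  then show ?thesis
    using assms c by (auto simp: continuous_algebra_hom_def tilde_hom_def eval_at_def)
qed


section \<open>Banach spaces and Banach bimodules\<close>

text \<open>Amenability quantifies over all Banach bimodules. A type cannot be quantified inside a
  formula, so a Banach space is a structure whose carrier is an arbitrary subset of a type
  \<open>'e\<close>, which plays the role of a universe; the operations only matter on the carrier.\<close>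

record 'e normed_structure =
  vcarrier :: "'e set"
  vadd :: "'e \<Rightarrow> 'e \<Rightarrow> 'e"
  vzero :: 'e
  vscale :: "complex \<Rightarrow> 'e \<Rightarrow> 'e"
  vnorm :: "'e \<Rightarrow> real"

definition vminus :: "('e, 'z) normed_structure_scheme \<Rightarrow> 'e \<Rightarrow> 'e \<Rightarrow> 'e" where
  "vminus E x y = vadd E x (vscale E (- 1) y)"

locale banach_space =
  fixes E :: "('e, 'z) normed_structure_scheme"
  assumes zero_closed: "vzero E \<in> vcarrier E"
    and add_closed: "\<lbrakk>x \<in> vcarrier E; y \<in> vcarrier E\<rbrakk> \<Longrightarrow> vadd E x y \<in> vcarrier E"
    and scale_closed: "x \<in> vcarrier E \<Longrightarrow> vscale E c x \<in> vcarrier E"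
    and add_assoc: "\<lbrakk>x \<in> vcarrier E; y \<in> vcarrier E; z \<in> vcarrier E\<rbrakk> \<Longrightarrow>
      vadd E (vadd E x y) z = vadd E x (vadd E y z)"
    and add_commute: "\<lbrakk>x \<in> vcarrier E; y \<in> vcarrier E\<rbrakk> \<Longrightarrow> vadd E x y = vadd E y x"
    and add_zero: "x \<in> vcarrier E \<Longrightarrow> vadd E (vzero E) x = x"
    and minus_self: "x \<in> vcarrier E \<Longrightarrow> vminus E x x = vzero E"
    and scale_add_right: "\<lbrakk>x \<in> vcarrier E; y \<in> vcarrier E\<rbrakk> \<Longrightarrow>
      vscale E c (vadd E x y) = vadd E (vscale E c x) (vscale E c y)"
    and scale_add_left: "x \<in> vcarrier E \<Longrightarrow>
      vscale E (c + d) x = vadd E (vscale E c x) (vscale E d x)"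
    and scale_scale: "x \<in> vcarrier E \<Longrightarrow> vscale E c (vscale E d x) = vscale E (c * d) x"
    and scale_one: "x \<in> vcarrier E \<Longrightarrow> vscale E 1 x = x"
    and norm_nonneg: "x \<in> vcarrier E \<Longrightarrow> 0 \<le> vnorm E x"
    and norm_eq_zero: "x \<in> vcarrier E \<Longrightarrow> vnorm E x = 0 \<longleftrightarrow> x = vzero E"
    and norm_triangle: "\<lbrakk>x \<in> vcarrier E; y \<in> vcarrier E\<rbrakk> \<Longrightarrow>
      vnorm E (vadd E x y) \<le> vnorm E x + vnorm E y"
    and norm_scale: "x \<in> vcarrier E \<Longrightarrow> vnorm E (vscale E c x) = cmod c * vnorm E x"
    and complete: "\<lbrakk>\<And>n. s n \<in> vcarrier E;
        \<And>\<epsilon>. \<epsilon> > 0 \<Longrightarrow> \<exists>N. \<forall>m\<ge>N. \<forall>n\<ge>N. vnorm E (vminus E (s m) (s n)) < \<epsilon>\<rbrakk> \<Longrightarrow>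
      \<exists>l\<in>vcarrier E. (\<lambda>n::nat. vnorm E (vminus E (s n) l)) \<longlonglongrightarrow> 0"

record ('b, 'e) bimodule_structure = "'e normed_structure" +
  lact :: "'b \<Rightarrow> 'e \<Rightarrow> 'e"
  ract :: "'e \<Rightarrow> 'b \<Rightarrow> 'e"

locale banach_bimodule = banach_space E
  for E :: "('b::complex_banach_algebra, 'e, 'z) bimodule_structure_scheme" +
  assumes lact_closed: "x \<in> vcarrier E \<Longrightarrow> lact E a x \<in> vcarrier E"
    and ract_closed: "x \<in> vcarrier E \<Longrightarrow> ract E x a \<in> vcarrier E"
    and lact_add_left: "x \<in> vcarrier E \<Longrightarrow> lact E (a + b) x = vadd E (lact E a x) (lact E b x)"
    and lact_add_right: "\<lbrakk>x \<in> vcarrier E; y \<in> vcarrier E\<rbrakk> \<Longrightarrow>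
      lact E a (vadd E x y) = vadd E (lact E a x) (lact E a y)"
    and lact_scale_left: "x \<in> vcarrier E \<Longrightarrow> lact E (c *\<^sub>C a) x = vscale E c (lact E a x)"
    and lact_scale_right: "x \<in> vcarrier E \<Longrightarrow> lact E a (vscale E c x) = vscale E c (lact E a x)"
    and ract_add_left: "\<lbrakk>x \<in> vcarrier E; y \<in> vcarrier E\<rbrakk> \<Longrightarrow>
      ract E (vadd E x y) a = vadd E (ract E x a) (ract E y a)"
    and ract_add_right: "x \<in> vcarrier E \<Longrightarrow> ract E x (a + b) = vadd E (ract E x a) (ract E x b)"
    and ract_scale_left: "x \<in> vcarrier E \<Longrightarrow> ract E (vscale E c x) a = vscale E c (ract E x a)"
    and ract_scale_right: "x \<in> vcarrier E \<Longrightarrow> ract E x (c *\<^sub>C a) = vscale E c (ract E x a)"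
    and lact_mult: "x \<in> vcarrier E \<Longrightarrow> lact E (a * b) x = lact E a (lact E b x)"
    and ract_mult: "x \<in> vcarrier E \<Longrightarrow> ract E x (a * b) = ract E (ract E x a) b"
    and lact_ract: "x \<in> vcarrier E \<Longrightarrow> ract E (lact E a x) b = lact E a (ract E x b)"
    and lact_bounded: "\<exists>K. \<forall>a. \<forall>x\<in>vcarrier E. vnorm E (lact E a x) \<le> K * norm a * vnorm E x"
    and ract_bounded: "\<exists>K. \<forall>a. \<forall>x\<in>vcarrier E. vnorm E (ract E x a) \<le> K * norm a * vnorm E x"


section \<open>The dual bimodule\<close>

text \<open>Functionals are made extensional (\<open>undefined\<close> off the carrier of \<open>E\<close>), so that equality in
  $E^*$ is equality of functions. The actions are the usual
  $(a \cdot \varphi)(x) = \varphi(x \cdot a)$ and $(\varphi \cdot a)(x) = \varphi(a \cdot x)$.\<close>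

definition dual_carrier :: "('e, 'z) normed_structure_scheme \<Rightarrow> ('e \<Rightarrow> complex) set" where
  "dual_carrier E = {\<phi> \<in> extensional (vcarrier E).
     (\<forall>x\<in>vcarrier E. \<forall>y\<in>vcarrier E. \<phi> (vadd E x y) = \<phi> x + \<phi> y) \<and>
     (\<forall>c. \<forall>x\<in>vcarrier E. \<phi> (vscale E c x) = c * \<phi> x) \<and>
     (\<exists>K. \<forall>x\<in>vcarrier E. cmod (\<phi> x) \<le> K * vnorm E x)}"

definition dual_norm :: "('e, 'z) normed_structure_scheme \<Rightarrow> ('e \<Rightarrow> complex) \<Rightarrow> real" where
  "dual_norm E \<phi> = (SUP x\<in>{x \<in> vcarrier E. vnorm E x \<le> 1}. cmod (\<phi> x))"

definition dual_bimodule ::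
    "('b, 'e, 'z) bimodule_structure_scheme \<Rightarrow> ('b, 'e \<Rightarrow> complex) bimodule_structure" where
  "dual_bimodule E = \<lparr>
     vcarrier = dual_carrier E,
     vadd = (\<lambda>\<phi> \<psi>. \<lambda>x\<in>vcarrier E. \<phi> x + \<psi> x),
     vzero = (\<lambda>x\<in>vcarrier E. 0),
     vscale = (\<lambda>c \<phi>. \<lambda>x\<in>vcarrier E. c * \<phi> x),
     vnorm = dual_norm E,
     lact = (\<lambda>a \<phi>. \<lambda>x\<in>vcarrier E. \<phi> (ract E x a)),
     ract = (\<lambda>\<phi> a. \<lambda>x\<in>vcarrier E. \<phi> (lact E a x))\<rparr>"


section \<open>Generalized derivations and amenability\<close>

definition theta_derivation ::
    "('b::complex_banach_algebra \<Rightarrow> 'b) \<Rightarrow> ('b, 'e, 'z) bimodule_structure_scheme \<Rightarrow> ('b \<Rightarrow> 'e) \<Rightarrow> bool"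
where
  "theta_derivation \<theta> E D \<longleftrightarrow>
     (\<forall>a. D a \<in> vcarrier E) \<and>
     (\<forall>a b. D (a + b) = vadd E (D a) (D b)) \<and>
     (\<forall>c a. D (c *\<^sub>C a) = vscale E c (D a)) \<and>
     (\<exists>K. \<forall>a. vnorm E (D a) \<le> K * norm a) \<and>
     (\<forall>a b. D (a * b) = vadd E (ract E (D a) (\<theta> b)) (lact E (\<theta> a) (D b)))"

definition theta_inner ::
    "('b \<Rightarrow> 'b) \<Rightarrow> ('b, 'e, 'z) bimodule_structure_scheme \<Rightarrow> ('b \<Rightarrow> 'e) \<Rightarrow> bool" where
  "theta_inner \<theta> E D \<longleftrightarrow>
     (\<exists>x\<in>vcarrier E. \<forall>a. D a = vminus E (lact E (\<theta> a) x) (ract E x (\<theta> a)))"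

text \<open>The type argument is the universe from which the carriers of the bimodules are taken. A
  theorem that is polymorphic in \<open>'e\<close> covers Banach bimodules of every cardinality.\<close>

definition theta_amenable ::
    "'e itself \<Rightarrow> ('b::complex_banach_algebra \<Rightarrow> 'b) \<Rightarrow> bool" where
  "theta_amenable _ \<theta> \<longleftrightarrow>
     (\<forall>E :: ('b, 'e) bimodule_structure. banach_bimodule E \<longrightarrow>
       (\<forall>D. theta_derivation \<theta> (dual_bimodule E) D \<longrightarrow> theta_inner \<theta> (dual_bimodule E) D))"


section \<open>The dual of a Banach bimodule is a Banach bimodule\<close>

lemma dual_carrierD:
  assumes "\<phi> \<in> dual_carrier E" "x \<in> vcarrier E"
  shows "y \<in> vcarrier E \<Longrightarrow> \<phi> (vadd E x y) = \<phi> x + \<phi> y" "\<phi> (vscale E c x) = c * \<phi> x"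
  using assms by (auto simp: dual_carrier_def)

context banach_space
begin

lemma dual_norm_bdd:
  assumes "\<phi> \<in> dual_carrier E"
  shows "bdd_above ((\<lambda>x. cmod (\<phi> x)) ` {x \<in> vcarrier E. vnorm E x \<le> 1})"
proof -
  obtain K where K: "\<forall>x\<in>vcarrier E. cmod (\<phi> x) \<le> K * vnorm E x"
    using assms by (auto simp: dual_carrier_def)
  have "cmod (\<phi> x) \<le> \<bar>K\<bar>" if x: "x \<in> vcarrier E" "vnorm E x \<le> 1" for x
  proof -
    have "cmod (\<phi> x) \<le> \<bar>K\<bar> * vnorm E x"
      using K x norm_nonneg[of x] by (meson abs_ge_self mult_right_mono order_trans)
    also have "\<dots> \<le> \<bar>K\<bar>" using x by (simp add: mult_left_le)
    finally show ?thesis .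
  qed
  then show ?thesis by (auto intro!: bdd_aboveI)
qed

lemma vnorm_zero: "vnorm E (vzero E) = 0"
  using norm_eq_zero zero_closed by blast

lemma dual_norm_nonneg:
  assumes "\<phi> \<in> dual_carrier E"
  shows "0 \<le> dual_norm E \<phi>"
  unfolding dual_norm_def
  by (rule cSUP_upper2[OF dual_norm_bdd[OF assms], of "vzero E"]) (auto simp: zero_closed vnorm_zero)

lemma dual_norm_le:
  assumes "\<And>x. x \<in> vcarrier E \<Longrightarrow> cmod (\<phi> x) \<le> K * vnorm E x" "0 \<le> K"
  shows "dual_norm E \<phi> \<le> K"
  unfolding dual_norm_def
proof (rule cSUP_least)
  show "{x \<in> vcarrier E. vnorm E x \<le> 1} \<noteq> {}"
    using zero_closed vnorm_zero by force
  fix x assume "x \<in> {x \<in> vcarrier E. vnorm E x \<le> 1}"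
  then have "cmod (\<phi> x) \<le> K * vnorm E x" "K * vnorm E x \<le> K"
    using assms by (auto simp: mult_left_le)
  then show "cmod (\<phi> x) \<le> K" by simp
qed

lemma dual_norm_bound:
  assumes \<phi>: "\<phi> \<in> dual_carrier E" and x: "x \<in> vcarrier E"
  shows "cmod (\<phi> x) \<le> dual_norm E \<phi> * vnorm E x"
proof (cases "vnorm E x = 0")
  case True
  obtain K where "\<forall>x\<in>vcarrier E. cmod (\<phi> x) \<le> K * vnorm E x"
    using \<phi> by (auto simp: dual_carrier_def)
  then show ?thesis using True x by fastforce
next
  case False
  then have pos: "vnorm E x > 0" using norm_nonneg[OF x] by simp
  define y where "y = vscale E (of_real (inverse (vnorm E x))) x"
  have y: "y \<in> vcarrier E" "vnorm E y \<le> 1"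
    using x pos by (auto simp: y_def scale_closed norm_scale norm_inverse)
  have "cmod (\<phi> y) \<le> dual_norm E \<phi>"
    unfolding dual_norm_def using y by (intro cSUP_upper dual_norm_bdd \<phi>) auto
  moreover have "cmod (\<phi> y) = inverse (vnorm E x) * cmod (\<phi> x)"
    using pos dual_carrierD(2)[OF \<phi> x] by (simp add: y_def norm_mult norm_inverse)
  ultimately show ?thesis using pos by (simp add: field_simps)
qed

lemma dual_carrierI:
  assumes "\<phi> \<in> extensional (vcarrier E)"
    "\<And>x y. \<lbrakk>x \<in> vcarrier E; y \<in> vcarrier E\<rbrakk> \<Longrightarrow> \<phi> (vadd E x y) = \<phi> x + \<phi> y"
    "\<And>c x. x \<in> vcarrier E \<Longrightarrow> \<phi> (vscale E c x) = c * \<phi> x"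
    "\<And>x. x \<in> vcarrier E \<Longrightarrow> cmod (\<phi> x) \<le> K * vnorm E x"
  shows "\<phi> \<in> dual_carrier E"
  unfolding dual_carrier_def using assms by blast

lemma dual_add_closed:
  assumes "\<phi> \<in> dual_carrier E" "\<psi> \<in> dual_carrier E"
  shows "(\<lambda>x\<in>vcarrier E. \<phi> x + \<psi> x) \<in> dual_carrier E"
proof (rule dual_carrierI[where K = "dual_norm E \<phi> + dual_norm E \<psi>"])
  fix x assume x: "x \<in> vcarrier E"
  then show "cmod ((\<lambda>x\<in>vcarrier E. \<phi> x + \<psi> x) x) \<le> (dual_norm E \<phi> + dual_norm E \<psi>) * vnorm E x"
    using dual_norm_bound[OF assms(1) x] dual_norm_bound[OF assms(2) x]
      norm_triangle_ineq[of "\<phi> x" "\<psi> x"] by (simp add: ring_distribs)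
qed (auto simp: add_closed scale_closed dual_carrierD[OF assms(1)] dual_carrierD[OF assms(2)]
    algebra_simps)

lemma dual_scale_closed:
  assumes "\<phi> \<in> dual_carrier E"
  shows "(\<lambda>x\<in>vcarrier E. c * \<phi> x) \<in> dual_carrier E"
proof (rule dual_carrierI[where K = "cmod c * dual_norm E \<phi>"])
  fix x assume x: "x \<in> vcarrier E"
  then show "cmod ((\<lambda>x\<in>vcarrier E. c * \<phi> x) x) \<le> cmod c * dual_norm E \<phi> * vnorm E x"
    using dual_norm_bound[OF assms x] by (simp add: norm_mult mult.assoc mult_left_mono)
qed (auto simp: add_closed scale_closed dual_carrierD[OF assms] algebra_simps)

lemma dual_zero_closed: "(\<lambda>x\<in>vcarrier E. 0) \<in> dual_carrier E"
  by (rule dual_carrierI[where K = 0]) (auto simp: add_closed scale_closed)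

lemma dual_norm_scale_le:
  assumes "\<phi> \<in> dual_carrier E"
  shows "dual_norm E (\<lambda>x\<in>vcarrier E. c * \<phi> x) \<le> cmod c * dual_norm E \<phi>"
  using dual_norm_bound[OF assms] dual_norm_nonneg[OF assms]
  by (intro dual_norm_le) (auto simp: norm_mult mult.assoc mult_left_mono)

lemma dual_ext:
  assumes "\<phi> \<in> dual_carrier E" "\<psi> \<in> dual_carrier E" "\<And>x. x \<in> vcarrier E \<Longrightarrow> \<phi> x = \<psi> x"
  shows "\<phi> = \<psi>"
  using assms by (auto simp: dual_carrier_def intro: extensionalityI)

lemma dual_complete:
  assumes s: "\<And>n. s n \<in> dual_carrier E"
    and cauchy: "\<And>\<epsilon>. \<epsilon> > 0 \<Longrightarrow>
      \<exists>N. \<forall>m\<ge>N. \<forall>n\<ge>N. dual_norm E (\<lambda>x\<in>vcarrier E. s m x - s n x) < \<epsilon>"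
  shows "\<exists>l\<in>dual_carrier E. (\<lambda>n::nat. dual_norm E (\<lambda>x\<in>vcarrier E. s n x - l x)) \<longlonglongrightarrow> 0"
proof -
  have diff: "(\<lambda>x\<in>vcarrier E. s m x - s n x) \<in> dual_carrier E" for m n
  proof -
    have "(\<lambda>x\<in>vcarrier E. s m x + (\<lambda>x\<in>vcarrier E. (- 1) * s n x) x) \<in> dual_carrier E"
      by (intro dual_add_closed dual_scale_closed s)
    moreover have "(\<lambda>x\<in>vcarrier E. s m x + (\<lambda>x\<in>vcarrier E. (- 1) * s n x) x)
        = (\<lambda>x\<in>vcarrier E. s m x - s n x)" by auto
    ultimately show ?thesis by simp
  qed
  have unif: "\<exists>N. \<forall>m\<ge>N. \<forall>n\<ge>N. \<forall>x\<in>vcarrier E. cmod (s m x - s n x) \<le> \<epsilon> * vnorm E x"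
    if e: "\<epsilon> > 0" for \<epsilon>
  proof -
    obtain N where N: "\<And>m n. \<lbrakk>m \<ge> N; n \<ge> N\<rbrakk> \<Longrightarrow> dual_norm E (\<lambda>x\<in>vcarrier E. s m x - s n x) < \<epsilon>"
      using cauchy[OF e] by blast
    have "cmod (s m x - s n x) \<le> \<epsilon> * vnorm E x" if "m \<ge> N" "n \<ge> N" "x \<in> vcarrier E" for m n x
    proof -
      have "cmod (s m x - s n x) \<le> dual_norm E (\<lambda>x\<in>vcarrier E. s m x - s n x) * vnorm E x"
        using dual_norm_bound[OF diff that(3), of m n] that by simp
      also have "\<dots> \<le> \<epsilon> * vnorm E x"
        using N[OF that(1,2)] norm_nonneg[OF that(3)] by (intro mult_right_mono) auto
      finally show ?thesis .
    qed
    then show ?thesis by blast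
  qed
  have "Cauchy (\<lambda>n. s n x)" if x: "x \<in> vcarrier E" for x
  proof (rule CauchyI)
    fix e :: real assume e: "e > 0"
    have nx: "0 \<le> vnorm E x" using norm_nonneg[OF x] .
    define d where "d = e / (2 * (vnorm E x + 1))"
    have "d > 0" using e nx by (simp add: d_def)
    then obtain N where N: "\<And>m n. \<lbrakk>m \<ge> N; n \<ge> N\<rbrakk> \<Longrightarrow> cmod (s m x - s n x) \<le> d * vnorm E x"
      using unif x by blast
    have "d * vnorm E x < e"
      using e nx by (simp add: d_def divide_simps)
    then show "\<exists>M. \<forall>m\<ge>M. \<forall>n\<ge>M. norm (s m x - s n x) < e"
      using N le_less_trans by blast
  qed
  then have "\<forall>x\<in>vcarrier E. \<exists>L. (\<lambda>n. s n x) \<longlonglongrightarrow> L"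
    by (simp add: Cauchy_convergent_iff convergent_def)
  then obtain L where L: "\<And>x. x \<in> vcarrier E \<Longrightarrow> (\<lambda>n. s n x) \<longlonglongrightarrow> L x"
    by metis
  define l where "l = (\<lambda>x\<in>vcarrier E. L x)"
  have l: "(\<lambda>n. s n x) \<longlonglongrightarrow> l x" if "x \<in> vcarrier E" for x
    using L that by (simp add: l_def)
  have lim: "\<exists>N. \<forall>n\<ge>N. \<forall>x\<in>vcarrier E. cmod (s n x - l x) \<le> \<epsilon> * vnorm E x" if "\<epsilon> > 0" for \<epsilon>
  proof -
    obtain N where N: "\<And>m n x. \<lbrakk>m \<ge> N; n \<ge> N; x \<in> vcarrier E\<rbrakk> \<Longrightarrow> cmod (s m x - s n x) \<le> \<epsilon> * vnorm E x"
      using unif[OF \<open>\<epsilon> > 0\<close>] by blast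
    have "cmod (s n x - l x) \<le> \<epsilon> * vnorm E x" if n: "n \<ge> N" and x: "x \<in> vcarrier E" for n x
    proof (rule LIMSEQ_le_const2)
      show "(\<lambda>m. cmod (s n x - s m x)) \<longlonglongrightarrow> cmod (s n x - l x)"
        by (intro tendsto_intros l x)
      show "\<exists>M. \<forall>m\<ge>M. cmod (s n x - s m x) \<le> \<epsilon> * vnorm E x"
        using N n x by blast
    qed
    then show ?thesis by blast
  qed
  have "l \<in> dual_carrier E"
  proof -
    obtain N where N: "\<And>x. x \<in> vcarrier E \<Longrightarrow> cmod (s N x - l x) \<le> 1 * vnorm E x"
      using lim[of 1] by auto
    show ?thesis
    proof (rule dual_carrierI[where K = "dual_norm E (s N) + 1"])
      show "l \<in> extensional (vcarrier E)" by (simp add: l_def)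
    next
      fix x y assume xy: "x \<in> vcarrier E" "y \<in> vcarrier E"
      have "(\<lambda>n. s n (vadd E x y)) \<longlonglongrightarrow> l x + l y"
        using tendsto_add[OF l[OF xy(1)] l[OF xy(2)]] by (simp add: dual_carrierD(1)[OF s xy])
      then show "l (vadd E x y) = l x + l y"
        using l[OF add_closed[OF xy]] LIMSEQ_unique by blast
    next
      fix c x assume x: "x \<in> vcarrier E"
      have "(\<lambda>n. s n (vscale E c x)) \<longlonglongrightarrow> c * l x"
        using tendsto_mult[OF tendsto_const l[OF x]] by (simp add: dual_carrierD(2)[OF s x])
      then show "l (vscale E c x) = c * l x"
        using l[OF scale_closed[OF x]] LIMSEQ_unique by blast
    next
      fix x assume x: "x \<in> vcarrier E"
      have "cmod (l x) \<le> cmod (s N x) + cmod (s N x - l x)"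
        by (metis norm_minus_commute norm_triangle_sub)
      then show "cmod (l x) \<le> (dual_norm E (s N) + 1) * vnorm E x"
        using N[OF x] dual_norm_bound[OF s x, of N] by (simp add: ring_distribs)
    qed
  qed
  moreover have "(\<lambda>n. dual_norm E (\<lambda>x\<in>vcarrier E. s n x - l x)) \<longlonglongrightarrow> 0"
  proof (rule LIMSEQ_I)
    fix r :: real assume "r > 0"
    then obtain N where N: "\<And>n x. \<lbrakk>n \<ge> N; x \<in> vcarrier E\<rbrakk> \<Longrightarrow> cmod (s n x - l x) \<le> r / 2 * vnorm E x"
      using lim[of "r / 2"] by auto
    have "norm (dual_norm E (\<lambda>x\<in>vcarrier E. s n x - l x) - 0) < r" if n: "n \<ge> N" for n
    proof -
      have "(\<lambda>x\<in>vcarrier E. s n x + (\<lambda>x\<in>vcarrier E. (- 1) * l x) x) \<in> dual_carrier E"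
        by (intro dual_add_closed dual_scale_closed s \<open>l \<in> dual_carrier E\<close>)
      moreover have "(\<lambda>x\<in>vcarrier E. s n x + (\<lambda>x\<in>vcarrier E. (- 1) * l x) x)
          = (\<lambda>x\<in>vcarrier E. s n x - l x)" by auto
      ultimately have "0 \<le> dual_norm E (\<lambda>x\<in>vcarrier E. s n x - l x)"
        using dual_norm_nonneg by simp
      moreover have "dual_norm E (\<lambda>x\<in>vcarrier E. s n x - l x) \<le> r / 2"
        using N[OF n] \<open>r > 0\<close> by (intro dual_norm_le) auto
      ultimately show ?thesis using \<open>r > 0\<close> by simp
    qed
    then show "\<exists>N. \<forall>n\<ge>N. norm (dual_norm E (\<lambda>x\<in>vcarrier E. s n x - l x) - 0) < r"
      by blast
  qed
  ultimately show ?thesis by blast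
qed

end

lemma dual_bimodule_simps:
  "vcarrier (dual_bimodule E) = dual_carrier E"
  "vadd (dual_bimodule E) = (\<lambda>\<phi> \<psi>. \<lambda>x\<in>vcarrier E. \<phi> x + \<psi> x)"
  "vzero (dual_bimodule E) = (\<lambda>x\<in>vcarrier E. 0)"
  "vscale (dual_bimodule E) = (\<lambda>c \<phi>. \<lambda>x\<in>vcarrier E. c * \<phi> x)"
  "vnorm (dual_bimodule E) = dual_norm E"
  "lact (dual_bimodule E) = (\<lambda>a \<phi>. \<lambda>x\<in>vcarrier E. \<phi> (ract E x a))"
  "ract (dual_bimodule E) = (\<lambda>\<phi> a. \<lambda>x\<in>vcarrier E. \<phi> (lact E a x))"
  "vminus (dual_bimodule E) = (\<lambda>\<phi> \<psi>. \<lambda>x\<in>vcarrier E. \<phi> x - \<psi> x)"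
  by (auto simp: dual_bimodule_def vminus_def fun_eq_iff)

context banach_bimodule
begin

lemma banach_space_dual: "banach_space (dual_bimodule E)"
proof (unfold_locales, unfold dual_bimodule_simps)
  show "(\<lambda>x\<in>vcarrier E. 0) \<in> dual_carrier E" by (rule dual_zero_closed)
next
  fix \<phi> \<psi> assume \<phi>: "\<phi> \<in> dual_carrier E" and \<psi>: "\<psi> \<in> dual_carrier E"
  show "(\<lambda>x\<in>vcarrier E. \<phi> x + \<psi> x) \<in> dual_carrier E" by (rule dual_add_closed[OF \<phi> \<psi>])
  have "cmod (\<phi> x + \<psi> x) \<le> (dual_norm E \<phi> + dual_norm E \<psi>) * vnorm E x" if "x \<in> vcarrier E" for x
    using dual_norm_bound[OF \<phi> that] dual_norm_bound[OF \<psi> that]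
      norm_triangle_ineq[of "\<phi> x" "\<psi> x"] by (simp add: ring_distribs)
  then show "dual_norm E (\<lambda>x\<in>vcarrier E. \<phi> x + \<psi> x) \<le> dual_norm E \<phi> + dual_norm E \<psi>"
    using dual_norm_nonneg[OF \<phi>] dual_norm_nonneg[OF \<psi>] by (intro dual_norm_le) auto
next
  fix \<phi> c assume \<phi>: "\<phi> \<in> dual_carrier E"
  show "(\<lambda>x\<in>vcarrier E. c * \<phi> x) \<in> dual_carrier E" by (rule dual_scale_closed[OF \<phi>])
  show "0 \<le> dual_norm E \<phi>" by (rule dual_norm_nonneg[OF \<phi>])
  show "(\<lambda>x\<in>vcarrier E. (\<lambda>x\<in>vcarrier E. 0) x + \<phi> x) = \<phi>"
    by (rule dual_ext[OF dual_add_closed[OF dual_zero_closed \<phi>] \<phi>]) auto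
  show "(\<lambda>x\<in>vcarrier E. 1 * \<phi> x) = \<phi>"
    by (rule dual_ext[OF dual_scale_closed[OF \<phi>] \<phi>]) auto
  have "\<phi> = (\<lambda>x\<in>vcarrier E. 0)" if "dual_norm E \<phi> = 0"
    using that dual_norm_bound[OF \<phi>] by (intro dual_ext dual_zero_closed \<phi>) auto
  moreover have "dual_norm E (\<lambda>x\<in>vcarrier E. 0) = 0"
    using dual_norm_nonneg[OF dual_zero_closed]
    by (intro antisym dual_norm_le) (auto)
  ultimately show "(dual_norm E \<phi> = 0) = (\<phi> = (\<lambda>x\<in>vcarrier E. 0))" by blast
  show "dual_norm E (\<lambda>x\<in>vcarrier E. c * \<phi> x) = cmod c * dual_norm E \<phi>"
  proof (cases "c = 0")
    case True
    then show ?thesis using \<open>dual_norm E (\<lambda>x\<in>vcarrier E. 0) = 0\<close> by simp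
  next
    case False
    have eq: "(\<lambda>x\<in>vcarrier E. inverse c * (\<lambda>x\<in>vcarrier E. c * \<phi> x) x) = \<phi>"
      by (rule dual_ext[OF dual_scale_closed[OF dual_scale_closed[OF \<phi>]] \<phi>]) (auto simp: False)
    have "dual_norm E \<phi> \<le> cmod (inverse c) * dual_norm E (\<lambda>x\<in>vcarrier E. c * \<phi> x)"
      using dual_norm_scale_le[OF dual_scale_closed[OF \<phi>, of c], of "inverse c"] unfolding eq .
    then have "cmod c * dual_norm E \<phi> \<le> dual_norm E (\<lambda>x\<in>vcarrier E. c * \<phi> x)"
      using False by (simp add: norm_inverse norm_divide field_simps)
    then show ?thesis using dual_norm_scale_le[OF \<phi>, of c] by simp
  qed
next
  fix s :: "nat \<Rightarrow> 'e \<Rightarrow> complex"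
  assume "\<And>n. s n \<in> dual_carrier E"
    "\<And>\<epsilon>. 0 < \<epsilon> \<Longrightarrow> \<exists>N. \<forall>m\<ge>N. \<forall>n\<ge>N. dual_norm E (\<lambda>x\<in>vcarrier E. s m x - s n x) < \<epsilon>"
  then show "\<exists>l\<in>dual_carrier E. (\<lambda>n. dual_norm E (\<lambda>x\<in>vcarrier E. s n x - l x)) \<longlonglongrightarrow> 0"
    by (rule dual_complete)
qed (auto simp: fun_eq_iff algebra_simps)

lemma dual_lact_closed:
  assumes \<phi>: "\<phi> \<in> dual_carrier E"
  shows "(\<lambda>x\<in>vcarrier E. \<phi> (ract E x a)) \<in> dual_carrier E"
proof -
  obtain K where K: "\<forall>a. \<forall>x\<in>vcarrier E. vnorm E (ract E x a) \<le> K * norm a * vnorm E x"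
    using ract_bounded by blast
  show ?thesis
  proof (rule dual_carrierI[where K = "dual_norm E \<phi> * (K * norm a)"])
    fix x assume x: "x \<in> vcarrier E"
    have "cmod (\<phi> (ract E x a)) \<le> dual_norm E \<phi> * vnorm E (ract E x a)"
      by (rule dual_norm_bound[OF \<phi> ract_closed[OF x]])
    also have "\<dots> \<le> dual_norm E \<phi> * (K * norm a * vnorm E x)"
      using K x by (intro mult_left_mono dual_norm_nonneg[OF \<phi>]) auto
    finally show "cmod ((\<lambda>x\<in>vcarrier E. \<phi> (ract E x a)) x) \<le> dual_norm E \<phi> * (K * norm a) * vnorm E x"
      using x by (simp add: mult.assoc)
  qed (auto simp: add_closed scale_closed ract_add_left ract_scale_left ract_closed dual_carrierD[OF \<phi>])
qed

lemma dual_ract_closed: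
  assumes \<phi>: "\<phi> \<in> dual_carrier E"
  shows "(\<lambda>x\<in>vcarrier E. \<phi> (lact E a x)) \<in> dual_carrier E"
proof -
  obtain K where K: "\<forall>a. \<forall>x\<in>vcarrier E. vnorm E (lact E a x) \<le> K * norm a * vnorm E x"
    using lact_bounded by blast
  show ?thesis
  proof (rule dual_carrierI[where K = "dual_norm E \<phi> * (K * norm a)"])
    fix x assume x: "x \<in> vcarrier E"
    have "cmod (\<phi> (lact E a x)) \<le> dual_norm E \<phi> * vnorm E (lact E a x)"
      by (rule dual_norm_bound[OF \<phi> lact_closed[OF x]])
    also have "\<dots> \<le> dual_norm E \<phi> * (K * norm a * vnorm E x)"
      using K x by (intro mult_left_mono dual_norm_nonneg[OF \<phi>]) auto
    finally show "cmod ((\<lambda>x\<in>vcarrier E. \<phi> (lact E a x)) x) \<le> dual_norm E \<phi> * (K * norm a) * vnorm E x"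
      using x by (simp add: mult.assoc)
  qed (auto simp: add_closed scale_closed lact_add_right lact_scale_right lact_closed dual_carrierD[OF \<phi>])
qed

lemma banach_bimodule_dual: "banach_bimodule (dual_bimodule E)"
proof (intro banach_bimodule.intro banach_space_dual banach_bimodule_axioms.intro,
    unfold dual_bimodule_simps)
  obtain K where K: "\<And>a x. x \<in> vcarrier E \<Longrightarrow> vnorm E (ract E x a) \<le> K * norm a * vnorm E x"
    using ract_bounded by blast
  have "dual_norm E (\<lambda>x\<in>vcarrier E. \<phi> (ract E x a)) \<le> \<bar>K\<bar> * norm a * dual_norm E \<phi>"
    if \<phi>: "\<phi> \<in> dual_carrier E" for a \<phi>
  proof (rule dual_norm_le)
    fix x assume x: "x \<in> vcarrier E"
    have "cmod (\<phi> (ract E x a)) \<le> dual_norm E \<phi> * vnorm E (ract E x a)"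
      by (rule dual_norm_bound[OF \<phi> ract_closed[OF x]])
    also have "\<dots> \<le> dual_norm E \<phi> * (\<bar>K\<bar> * norm a * vnorm E x)"
    proof (rule mult_left_mono[OF _ dual_norm_nonneg[OF \<phi>]])
      have "K * norm a * vnorm E x \<le> \<bar>K\<bar> * norm a * vnorm E x"
        using norm_nonneg[OF x] by (intro mult_right_mono) auto
      then show "vnorm E (ract E x a) \<le> \<bar>K\<bar> * norm a * vnorm E x"
        using K[OF x, of a] by simp
    qed
    finally show "cmod ((\<lambda>x\<in>vcarrier E. \<phi> (ract E x a)) x) \<le> \<bar>K\<bar> * norm a * dual_norm E \<phi> * vnorm E x"
      using x by (simp add: mult_ac)
  qed (use dual_norm_nonneg[OF \<phi>] in auto)
  then show "\<exists>K. \<forall>a. \<forall>\<phi>\<in>dual_carrier E.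
      dual_norm E (\<lambda>x\<in>vcarrier E. \<phi> (ract E x a)) \<le> K * norm a * dual_norm E \<phi>" by blast
next
  obtain K where K: "\<And>a x. x \<in> vcarrier E \<Longrightarrow> vnorm E (lact E a x) \<le> K * norm a * vnorm E x"
    using lact_bounded by blast
  have "dual_norm E (\<lambda>x\<in>vcarrier E. \<phi> (lact E a x)) \<le> \<bar>K\<bar> * norm a * dual_norm E \<phi>"
    if \<phi>: "\<phi> \<in> dual_carrier E" for a \<phi>
  proof (rule dual_norm_le)
    fix x assume x: "x \<in> vcarrier E"
    have "cmod (\<phi> (lact E a x)) \<le> dual_norm E \<phi> * vnorm E (lact E a x)"
      by (rule dual_norm_bound[OF \<phi> lact_closed[OF x]])
    also have "\<dots> \<le> dual_norm E \<phi> * (\<bar>K\<bar> * norm a * vnorm E x)"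
    proof (rule mult_left_mono[OF _ dual_norm_nonneg[OF \<phi>]])
      have "K * norm a * vnorm E x \<le> \<bar>K\<bar> * norm a * vnorm E x"
        using norm_nonneg[OF x] by (intro mult_right_mono) auto
      then show "vnorm E (lact E a x) \<le> \<bar>K\<bar> * norm a * vnorm E x"
        using K[OF x, of a] by simp
    qed
    finally show "cmod ((\<lambda>x\<in>vcarrier E. \<phi> (lact E a x)) x) \<le> \<bar>K\<bar> * norm a * dual_norm E \<phi> * vnorm E x"
      using x by (simp add: mult_ac)
  qed (use dual_norm_nonneg[OF \<phi>] in auto)
  then show "\<exists>K. \<forall>a. \<forall>\<phi>\<in>dual_carrier E.
      dual_norm E (\<lambda>x\<in>vcarrier E. \<phi> (lact E a x)) \<le> K * norm a * dual_norm E \<phi>" by blast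
qed (auto simp: fun_eq_iff dual_lact_closed dual_ract_closed lact_closed ract_closed dual_carrierD
    lact_add_left ract_add_right lact_scale_left ract_scale_right lact_mult ract_mult lact_ract)

end

end

theory Submission
  imports Defs
begin

text \<open>Amenability passes to quotients: along a surjective homomorphism \<open>\<pi> : B \<rightarrow> A\<close> that
  intertwines the twists, every Banach \<open>A\<close>-bimodule becomes a Banach \<open>B\<close>-bimodule, and composing a
  derivation of \<open>A\<close> with \<open>\<pi>\<close> gives a derivation of \<open>B\<close> with the same implementing elements. The
  theorem is the case where \<open>\<pi>\<close> is evaluation at \<open>x\<^sub>0\<close>.\<close>

text \<open>Bimodule and derivation axioms ask for explicit constants, while
  \<open>continuous_algebra_hom\<close> asks only for continuity. Continuity at 0 gives a ball of
  radius \<open>d\<close> mapped into the unit ball, and rescaling turns it into the bound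
  \<open>2 / d\<close>.\<close>

lemma continuous_algebra_hom_bounded:
  assumes "continuous_algebra_hom \<pi>"
  obtains K where "K > 0" "\<And>a. norm (\<pi> a) \<le> K * norm a"
proof -
  have "linear \<pi>"
    using assms by (intro linearI) (auto simp: continuous_algebra_hom_def scaleC_of_real[symmetric])
  moreover have "continuous_on UNIV \<pi>"
    using assms by (simp add: continuous_algebra_hom_def)
  ultimately obtain d where d: "d > 0" "\<And>a. norm a < d \<Longrightarrow> norm (\<pi> a) < 1"
    unfolding continuous_on_iff
    by (metis UNIV_I dist_0_norm dist_commute linear_0 zero_less_one)
  have "norm (\<pi> a) \<le> 2 / d * norm a" for a
  proof (cases "a = 0")
    case True
    then show ?thesis using linear_0[OF \<open>linear \<pi>\<close>] by simp
  next
    case False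
    \<comment> \<open>This factor moves \<open>a\<close> to norm \<open>d / 2\<close>, strictly
      inside the ball.\<close>
    define r where "r = d / (2 * norm a)"
    have r: "r > 0" using False d(1) by (simp add: r_def)
    have "norm (r *\<^sub>R a) < d" using False d(1) by (simp add: r_def)
    then have "norm (\<pi> (r *\<^sub>R a)) < 1" by (rule d(2))
    then have "r * norm (\<pi> a) < 1"
      using r linear_scale[OF \<open>linear \<pi>\<close>] by simp
    then show ?thesis
      using False d(1) by (simp add: r_def field_simps)
  qed
  then show ?thesis using d(1) that[of "2 / d"] by simp
qed

definition pullback_bimodule ::
    "('b \<Rightarrow> 'a) \<Rightarrow> ('a, 'e) bimodule_structure \<Rightarrow> ('b, 'e) bimodule_structure" where
  "pullback_bimodule \<pi> E = \<lparr>
     vcarrier = vcarrier E, vadd = vadd E, vzero = vzero E, vscale = vscale E, vnorm = vnorm E,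
     lact = (\<lambda>b. lact E (\<pi> b)), ract = (\<lambda>x b. ract E x (\<pi> b))\<rparr>"

lemma pullback_bimodule_simps [simp]:
  "vcarrier (pullback_bimodule \<pi> E) = vcarrier E"
  "vadd (pullback_bimodule \<pi> E) = vadd E"
  "vzero (pullback_bimodule \<pi> E) = vzero E"
  "vscale (pullback_bimodule \<pi> E) = vscale E"
  "vnorm (pullback_bimodule \<pi> E) = vnorm E"
  "vminus (pullback_bimodule \<pi> E) = vminus E"
  "lact (pullback_bimodule \<pi> E) b = lact E (\<pi> b)"
  "ract (pullback_bimodule \<pi> E) x b = ract E x (\<pi> b)"
  by (auto simp: pullback_bimodule_def vminus_def fun_eq_iff)

text \<open>Carrier and norm of the dual depend only on the underlying Banach space, which pulling
  back leaves alone. Hence results on pullbacks of arbitrary bimodules apply directly to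
  duals.\<close>

lemma dual_pullback_bimodule:
  "dual_bimodule (pullback_bimodule \<pi> E) = pullback_bimodule \<pi> (dual_bimodule E)"
proof -
  have "dual_carrier (pullback_bimodule \<pi> E) = dual_carrier E"
    "dual_norm (pullback_bimodule \<pi> E) = dual_norm E"
    by (auto simp: dual_carrier_def dual_norm_def fun_eq_iff)
  then show ?thesis
    by (simp add: dual_bimodule_def pullback_bimodule_def)
qed

lemma banach_bimodule_pullback:
  assumes hom: "continuous_algebra_hom \<pi>" and E: "banach_bimodule E"
  shows "banach_bimodule (pullback_bimodule \<pi> E)"
proof -
  interpret banach_bimodule E by (rule E)
  obtain M where M: "M > 0" "\<And>b. norm (\<pi> b) \<le> M * norm b"
    using continuous_algebra_hom_bounded[OF hom] by blast
  \<comment> \<open>\<open>act\<close> stands for either action, the right one with its arguments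
    swapped.\<close>
  have bound: "\<exists>K. \<forall>b. \<forall>x\<in>vcarrier E. vnorm E (act (\<pi> b) x) \<le> K * norm b * vnorm E x"
    if act: "\<exists>K. \<forall>a. \<forall>x\<in>vcarrier E. vnorm E (act a x) \<le> K * norm a * vnorm E x" for act
  proof -
    obtain K where K: "\<And>a x. x \<in> vcarrier E \<Longrightarrow> vnorm E (act a x) \<le> K * norm a * vnorm E x"
      using act by blast
    have "vnorm E (act (\<pi> b) x) \<le> \<bar>K\<bar> * M * norm b * vnorm E x" if x: "x \<in> vcarrier E" for b x
    proof -
      \<comment> \<open>The axiom does not say that \<open>K\<close> is nonnegative, hence the
        absolute value.\<close>
      have "K * norm (\<pi> b) \<le> \<bar>K\<bar> * (M * norm b)"
        using M by (intro mult_mono) auto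
      then have "K * norm (\<pi> b) * vnorm E x \<le> \<bar>K\<bar> * (M * norm b) * vnorm E x"
        using norm_nonneg[OF x] by (rule mult_right_mono)
      with K[OF x, of "\<pi> b"] show ?thesis by (simp add: mult.assoc)
    qed
    then show ?thesis by blast
  qed
  have "banach_space (pullback_bimodule \<pi> E)"
    by unfold_locales
      (auto simp: zero_closed add_closed scale_closed add_assoc add_zero minus_self
        scale_add_right scale_add_left scale_scale scale_one norm_nonneg norm_eq_zero
        norm_triangle norm_scale intro: add_commute complete)
  moreover have "banach_bimodule_axioms (pullback_bimodule \<pi> E)"
    using hom bound[OF lact_bounded] bound[of "\<lambda>a x. ract E x a", OF ract_bounded]
    by (intro banach_bimodule_axioms.intro)
      (auto simp: continuous_algebra_hom_def lact_closed ract_closed lact_add_left lact_add_right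
        lact_scale_left lact_scale_right ract_add_left ract_add_right ract_scale_left
        ract_scale_right lact_mult ract_mult lact_ract)
  ultimately show ?thesis by (rule banach_bimodule.intro)
qed

text \<open>In the product rule for \<open>D\<close> at \<open>\<pi> a\<close> and
  \<open>\<pi> b\<close> the twist is \<open>\<eta> (\<pi> b) = \<pi> (\<theta> b)\<close>, which
  acts on \<open>E\<close> as \<open>\<theta> b\<close> acts on the pullback.\<close>

lemma theta_derivation_pullback:
  assumes hom: "continuous_algebra_hom \<pi>" and E: "banach_bimodule E"
    and intertwine: "\<pi> \<circ> \<theta> = \<eta> \<circ> \<pi>" and D: "theta_derivation \<eta> E D"
  shows "theta_derivation \<theta> (pullback_bimodule \<pi> E) (D \<circ> \<pi>)"
proof -
  have eq: "\<pi> (\<theta> b) = \<eta> (\<pi> b)" for b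
    using intertwine by (simp add: fun_eq_iff)
  obtain M where M: "M > 0" "\<And>b. norm (\<pi> b) \<le> M * norm b"
    using continuous_algebra_hom_bounded[OF hom] by blast
  obtain K where K: "\<And>a. vnorm E (D a) \<le> K * norm a"
    using D by (auto simp: theta_derivation_def)
  have "vnorm E (D (\<pi> b)) \<le> \<bar>K\<bar> * M * norm b" for b
  proof -
    have "K * norm (\<pi> b) \<le> \<bar>K\<bar> * (M * norm b)"
      using M by (intro mult_mono) auto
    with K[of "\<pi> b"] show ?thesis by (simp add: mult.assoc)
  qed
  then have "\<exists>K. \<forall>b. vnorm E (D (\<pi> b)) \<le> K * norm b" by blast
  with hom D show ?thesis
    by (simp add: theta_derivation_def continuous_algebra_hom_def eq)
qed

text \<open>The same \<open>x\<close> implements \<open>D\<close>: the identity holds at every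
  \<open>\<pi> b\<close>, and surjectivity makes these all of the algebra.\<close>

lemma theta_inner_pullbackD:
  assumes "theta_inner \<theta> (pullback_bimodule \<pi> E) (D \<circ> \<pi>)"
    and intertwine: "\<pi> \<circ> \<theta> = \<eta> \<circ> \<pi>" and "surj \<pi>"
  shows "theta_inner \<eta> E D"
proof -
  have eq: "\<pi> (\<theta> b) = \<eta> (\<pi> b)" for b
    using intertwine by (simp add: fun_eq_iff)
  obtain x where x: "x \<in> vcarrier E"
    "\<And>b. D (\<pi> b) = vminus E (lact E (\<eta> (\<pi> b)) x) (ract E x (\<eta> (\<pi> b)))"
    using assms(1) by (auto simp: theta_inner_def eq)
  then have "D a = vminus E (lact E (\<eta> a) x) (ract E x (\<eta> a))" for a
    using \<open>surj \<pi>\<close> by (metis surjD)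
  with x(1) show ?thesis by (auto simp: theta_inner_def)
qed

text \<open>One universe \<open>'e\<close> serves both algebras because a pullback has the same
  carrier as the original bimodule.\<close>

lemma theta_amenable_surj_hom:
  fixes \<theta> :: "'b::complex_banach_algebra \<Rightarrow> 'b" and \<eta> :: "'a::complex_banach_algebra \<Rightarrow> 'a"
  assumes hom: "continuous_algebra_hom \<pi>" and "surj \<pi>" and intertwine: "\<pi> \<circ> \<theta> = \<eta> \<circ> \<pi>"
    and amenable: "theta_amenable TYPE('e) \<theta>"
  shows "theta_amenable TYPE('e) \<eta>"
  unfolding theta_amenable_def
proof (intro allI impI)
  fix E :: "('a, 'e) bimodule_structure" and D
  assume E: "banach_bimodule E" and D: "theta_derivation \<eta> (dual_bimodule E) D"
  have "theta_derivation \<theta> (dual_bimodule (pullback_bimodule \<pi> E)) (D \<circ> \<pi>)"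
    unfolding dual_pullback_bimodule
    by (intro theta_derivation_pullback[OF hom _ intertwine D]
        banach_bimodule.banach_bimodule_dual E)
  then have "theta_inner \<theta> (dual_bimodule (pullback_bimodule \<pi> E)) (D \<circ> \<pi>)"
    using amenable banach_bimodule_pullback[OF hom E] by (auto simp: theta_amenable_def)
  then show "theta_inner \<eta> (dual_bimodule E) D"
    unfolding dual_pullback_bimodule by (rule theta_inner_pullbackD[OF _ intertwine \<open>surj \<pi>\<close>])
qed

text \<open>Continuity holds because evaluation does not increase supremum distance.\<close>

lemma continuous_algebra_hom_eval_at: "continuous_algebra_hom (eval_at x)"
proof -
  have "continuous_on UNIV (eval_at x)"
    unfolding continuous_on_iff eval_at_def by (meson dist_bounded le_less_trans)
  then show ?thesis by (simp add: continuous_algebra_hom_def eval_at_def)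
qed

text \<open>Constant functions give a right inverse.\<close>

lemma surj_eval_at: "surj (eval_at x)"
  by (rule surjI[where f = const_bcontfun]) (simp add: eval_at_def)

theorem theorem2p4:
  fixes \<tau> :: "('x::t2_space \<Rightarrow>\<^sub>C 'a::complex_banach_algebra) \<Rightarrow> ('x \<Rightarrow>\<^sub>C 'a)"
    and x0 :: 'x
  assumes "compact (UNIV :: 'x set)"
    and "continuous_algebra_hom \<tau>"
    and "eval_at x0 \<circ> \<tau> = tilde_hom \<tau> x0 \<circ> eval_at x0"
    and "theta_amenable TYPE('e) \<tau>"
  shows "theta_amenable TYPE('e) (tilde_hom \<tau> x0)"
  by (rule theta_amenable_surj_hom[OF continuous_algebra_hom_eval_at surj_eval_at assms(3,4)])

end
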